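(* The following continued fraction expansion holds: $$\zeta(3)=\cfrac{9}{8+\cfrac{-184}{359+\cfrac{-30672}{\mathcal{Q}_3+\cfrac{\mathcal{P}_4}{\mathcal{Q}_4+\cdots+\cfrac{\mathcal{P}_n}{\mathcal{Q}_n+\cdots}}}}},$$ where $$\mathcal{P}_n=-9(n-2)^3(n-1)^3\left(28n^3-213n^2+543n-464\right)\left(28n^3-45n^2+27n-6\right)\qquad(n\ge4),$$ $$\mathcal{Q}_n=6\left(476n^6-2907n^5+7077n^4-8715n^3+5715n^2-1926n+264\right)\qquad(n\ge3).$$
   Context: $\zeta(3)=\sum_{m\ge1}m^{-3}$. An infinite (irregular) continued fraction $\cfrac{b_1}{a_1+\cfrac{b_2}{a_2+\cdots}}$ equals a number $x$ if its convergents $p_n/q_n$ tend to $x$ as $n\to\infty$, where $p_{-1}=1$, $p_0=0$, $q_{-1}=0$, $q_0=1$, and $p_n=a_np_{n-1}+b_np_{n-2}$, $q_n=a_nq_{n-1}+b_nq_{n-2}$ for $n\ge1$. Here the partial numerators are $b_1=9$, $b_2=-184$, $b_3=-30672$, $b_n=\mathcal{P}_n$ for $n\ge4$, and the partial denominators are $a_1=8$, $a_2=359$, $a_n=\mathcal{Q}_n$ for $n\ge3$. *)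

theory Defs
  imports Complex_Main
begin

text \<open>
  Numerators and denominators of the convergents of the continued fraction
  \<open>b 1 / (a 1 + b 2 / (a 2 + \<dots>))\<close>.  The values at index \<open>-1\<close>, namely \<open>p = 1\<close> and \<open>q = 0\<close>,
  occur only in the equations for \<open>Suc 0\<close>, where they have been inserted into the recurrence.
  The values \<open>a 0\<close> and \<open>b 0\<close> are never used.
\<close>

fun cf_num :: "(nat \<Rightarrow> real) \<Rightarrow> (nat \<Rightarrow> real) \<Rightarrow> nat \<Rightarrow> real" where
  "cf_num a b 0 = 0"
| "cf_num a b (Suc 0) = a 1 * 0 + b 1 * 1"
| "cf_num a b (Suc (Suc n)) =
     a (n + 2) * cf_num a b (Suc n) + b (n + 2) * cf_num a b n"

fun cf_den :: "(nat \<Rightarrow> real) \<Rightarrow> (nat \<Rightarrow> real) \<Rightarrow> nat \<Rightarrow> real" where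
  "cf_den a b 0 = 1"
| "cf_den a b (Suc 0) = a 1 * 1 + b 1 * 0"
| "cf_den a b (Suc (Suc n)) =
     a (n + 2) * cf_den a b (Suc n) + b (n + 2) * cf_den a b n"

text \<open>
  Since \<open>x / 0 = 0\<close> in HOL, the requirement that the convergents are defined from some index on
  is stated explicitly.
\<close>

definition cf_equals :: "(nat \<Rightarrow> real) \<Rightarrow> (nat \<Rightarrow> real) \<Rightarrow> real \<Rightarrow> bool" where
  "cf_equals a b x \<longleftrightarrow>
     (\<forall>\<^sub>F n in sequentially. cf_den a b n \<noteq> 0) \<and>
     (\<lambda>n. cf_num a b n / cf_den a b n) \<longlonglongrightarrow> x"

definition zeta3 :: real where
  "zeta3 = (\<Sum>m. 1 / real (Suc m) ^ 3)"

definition P_poly :: "real \<Rightarrow> real" where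
  "P_poly n = - 9 * (n - 2) ^ 3 * (n - 1) ^ 3
     * (28 * n ^ 3 - 213 * n ^ 2 + 543 * n - 464)
     * (28 * n ^ 3 - 45 * n ^ 2 + 27 * n - 6)"

definition Q_poly :: "real \<Rightarrow> real" where
  "Q_poly n = 6 * (476 * n ^ 6 - 2907 * n ^ 5 + 7077 * n ^ 4 - 8715 * n ^ 3
     + 5715 * n ^ 2 - 1926 * n + 264)"

text \<open>\<open>P_poly 3\<close> is not the third partial numerator: it equals \<open>4 * (- 30672)\<close>.\<close>

definition partial_num :: "nat \<Rightarrow> real" where
  "partial_num n =
     (if n = 1 then 9 else if n = 2 then - 184 else if n = 3 then - 30672
      else P_poly (real n))"

definition partial_den :: "nat \<Rightarrow> real" where
  "partial_den n =
     (if n = 1 then 8 else if n = 2 then 359 else Q_poly (real n))"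

end

theory Submission
  imports Defs "HOL-Analysis.Summation_Tests"
begin

text \<open>
  The continued fraction is Apery's in disguise.  Let
  \[ B_n = \sum_k {n \choose k}^2 {n+k \choose k}^2, \qquad
     A_n = \sum_k {n \choose k}^2 {n+k \choose k}^2 c_{n,k} \]
  be Apery's denominators and numerators, where \<open>c n k\<close> is the \<open>n\<close>-th partial sum of \<open>\<zeta>(3)\<close> plus
  a correction of size \<open>O(1/n)\<close> that is uniform in \<open>k\<close>.  Then \<open>A n / B n\<close> is a weighted mean of
  numbers that tend to \<open>\<zeta>(3)\<close> uniformly, so it tends to \<open>\<zeta>(3)\<close> as well (\<open>apery_num_bound\<close>).

  Both sequences satisfy Apery's three-term recurrence (\<open>apery_den_recurrence\<close>,
  \<open>apery_num_recurrence\<close>).  The proofs are by creative telescoping with the certificates of Zagier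
  and Cohen: applied to the summand, the recurrence operator gives a difference in \<open>k\<close>.

  The convergents of the continued fraction are, up to a common factor \<open>cf_scale n\<close>, the
  combinations \<open>3 A (n+1) + A n\<close> and \<open>3 B (n+1) + B n\<close>.  Indeed \<open>3 X (n+1) + X n\<close> satisfies, for every
  solution \<open>X\<close> of Apery's recurrence, a three-term recurrence whose coefficients are, after
  rescaling, the given partial numerators and denominators (\<open>combination_recurrence\<close>,
  \<open>cf_solution_eq\<close>).  Since the \<open>B n\<close> are positive, the quotient of the combinations lies between
  \<open>A n / B n\<close> and \<open>A (n+1) / B (n+1)\<close>, and therefore has the same limit.
\<close>

section \<open>The summands of Apery's sums\<close>

definition apery_weight :: "nat \<Rightarrow> nat \<Rightarrow> real" where
  "apery_weight n k = real (n choose k) * real (n + k choose k)"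

lemma apery_weight_0 [simp]: "apery_weight n 0 = 1"
  by (simp add: apery_weight_def)

lemma apery_weight_eq_0: "n < k \<Longrightarrow> apery_weight n k = 0"
  by (simp add: apery_weight_def)

lemma apery_weight_pos: "k \<le> n \<Longrightarrow> apery_weight n k > 0"
  by (simp add: apery_weight_def)

lemma binomial_Suc_right_real:
  "real (Suc k) * real (n choose Suc k) = (real n - real k) * real (n choose k)"
proof (cases "k \<le> n")
  case True
  have "Suc k * (n choose Suc k) = (n - k) * (n choose k)"
    by (simp only: binomial_absorb_comp binomial_absorption)
  then have "real (Suc k * (n choose Suc k)) = real ((n - k) * (n choose k))"
    by (simp only:)
  with True show ?thesis by (simp only: of_nat_mult of_nat_diff)
qed (simp add: binomial_eq_0)

lemma binomial_Suc_left_real: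
  "(real (Suc n) - real k) * real (Suc n choose k) = real (Suc n) * real (n choose k)"
proof (cases "k \<le> Suc n")
  case True
  have "(Suc n - k) * (Suc n choose k) = Suc n * (n choose k)"
    using binomial_absorb_comp[of "Suc n" k] by simp
  then have "real ((Suc n - k) * (Suc n choose k)) = real (Suc n * (n choose k))"
    by (simp only:)
  with True show ?thesis by (simp only: of_nat_mult of_nat_diff)
qed (simp add: binomial_eq_0)

lemma apery_weight_Suc_right:
  "apery_weight n (Suc k) * (real k + 1)\<^sup>2
     = apery_weight n k * (real n - real k) * (real n + real k + 1)"
proof -
  have "Suc k * (Suc (n + k) choose Suc k) = Suc (n + k) * (n + k choose k)"
    by (rule Suc_times_binomial)
  then have "real (Suc k * (Suc (n + k) choose Suc k)) = real (Suc (n + k) * (n + k choose k))"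
    by (simp only:)
  then have 1: "(real k + 1) * real (n + Suc k choose Suc k)
      = (real n + real k + 1) * real (n + k choose k)"
    by (simp add: algebra_simps del: binomial_Suc_Suc)
  have 2: "(real k + 1) * real (n choose Suc k) = (real n - real k) * real (n choose k)"
    using binomial_Suc_right_real[of k n] by (simp add: algebra_simps)
  have "apery_weight n (Suc k) * (real k + 1)\<^sup>2
      = ((real k + 1) * real (n choose Suc k)) * ((real k + 1) * real (n + Suc k choose Suc k))"
    by (simp add: apery_weight_def power2_eq_square del: binomial_Suc_Suc)
  also have "\<dots> = apery_weight n k * (real n - real k) * (real n + real k + 1)"
    unfolding 1 2 by (simp add: apery_weight_def)
  finally show ?thesis .
qed

lemma apery_weight_Suc_left:
  "apery_weight (Suc n) k * (real n + 1 - real k) = apery_weight n k * (real n + 1 + real k)"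
proof -
  have 1: "(real n + 1 - real k) * real (Suc n choose k) = (real n + 1) * real (n choose k)"
    using binomial_Suc_left_real[of n k] by (simp add: algebra_simps del: binomial_Suc_Suc)
  have "(real (Suc (n + k)) - real k) * real (Suc (n + k) choose k)
      = real (Suc (n + k)) * real (n + k choose k)"
    by (rule binomial_Suc_left_real)
  then have 2: "(real n + 1) * real (Suc n + k choose k) = (real n + 1 + real k) * real (n + k choose k)"
    by (simp add: algebra_simps)
  have "(real n + 1) * (apery_weight (Suc n) k * (real n + 1 - real k))
     = ((real n + 1 - real k) * real (Suc n choose k)) * ((real n + 1) * real (Suc n + k choose k))"
    by (simp add: apery_weight_def)
  also have "\<dots> = (real n + 1) * (apery_weight n k * (real n + 1 + real k))"
    unfolding 1 2 by (simp add: apery_weight_def)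
  finally show ?thesis by (simp add: add_nonneg_eq_0_iff)
qed

text \<open>
  In the next two lemmas the factor that would vanish at the edge \<open>k = n\<close> of the triangle has been
  cancelled.  All weights around \<open>(n, k)\<close> are thereby polynomial multiples of the single weight
  at \<open>(n, k)\<close>, up to the factor \<open>(k + 1)\<^sup>2\<close>, and identities between them need no case
  distinction at the edge.
\<close>

lemma apery_weight_Suc_Suc:
  "apery_weight (Suc n) (Suc k) * (real k + 1)\<^sup>2
     = apery_weight n k * (real n + real k + 1) * (real n + real k + 2)"
proof (cases "k = n")
  case True
  have "apery_weight (Suc n) (Suc n) * (real n + 1)\<^sup>2
      = apery_weight (Suc n) n * (2 * real n + 2)"
    using apery_weight_Suc_right[of "Suc n" n] by (simp add: algebra_simps)
  moreover have "apery_weight (Suc n) n = apery_weight n n * (2 * real n + 1)"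
    using apery_weight_Suc_left[of n n] by (simp add: algebra_simps)
  ultimately show ?thesis using True by (simp add: algebra_simps)
next
  case False
  then have nz: "real n - real k \<noteq> 0" by simp
  have "(real n - real k) * (apery_weight (Suc n) (Suc k) * (real k + 1)\<^sup>2)
      = apery_weight n (Suc k) * (real k + 1)\<^sup>2 * (real n + real k + 2)"
    using arg_cong[OF apery_weight_Suc_left[of n "Suc k"], of "\<lambda>z. z * (real k + 1)\<^sup>2"]
    by (simp add: algebra_simps)
  also have "\<dots> = (real n - real k)
      * (apery_weight n k * (real n + real k + 1) * (real n + real k + 2))"
    unfolding apery_weight_Suc_right by simp
  finally show ?thesis using nz by simp
qed

lemma apery_weight_pred_Suc:
  "apery_weight n (Suc k) * (real k + 1)\<^sup>2
     = apery_weight (Suc n) k * (real n + 1 - real k) * (real n - real k)"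
proof -
  have "apery_weight n (Suc k) * (real k + 1)\<^sup>2
      = apery_weight n k * (real n - real k) * (real n + real k + 1)"
    by (rule apery_weight_Suc_right)
  also have "\<dots> = (apery_weight n k * (real n + 1 + real k)) * (real n - real k)"
    by (simp add: algebra_simps)
  also have "\<dots> = apery_weight (Suc n) k * (real n + 1 - real k) * (real n - real k)"
    by (simp add: apery_weight_Suc_left)
  finally show ?thesis .
qed

lemma Suc_le_apery_weight:
  assumes "0 < k" "k \<le> n"
  shows "real n + 1 \<le> apery_weight n k"
proof -
  have "Suc n \<le> n + k choose n"
    using binomial_right_mono[of "Suc n" "n + k" n] assms by simp
  also have "n + k choose n = n + k choose k"
    using binomial_symmetric[of k "n + k"] by simp
  finally have 1: "real (Suc n) \<le> real (n + k choose k)" by (simp only: of_nat_le_iff)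
  have "Suc 0 \<le> n choose k"
    using assms by (simp add: Suc_le_eq)
  then have "1 \<le> real (n choose k)" by simp
  from mult_mono[OF this 1] show ?thesis by (simp add: apery_weight_def)
qed

section \<open>Apery's recurrence for the denominators\<close>

definition apery_den :: "nat \<Rightarrow> real" where
  "apery_den n = (\<Sum>k\<le>n. (apery_weight n k)\<^sup>2)"

definition apery_poly :: "real \<Rightarrow> real" where
  "apery_poly x = 34 * x ^ 3 + 51 * x ^ 2 + 27 * x + 5"

text \<open>
  The recurrence is centred at \<open>n + 1\<close>, so that it relates three consecutive natural indices without
  subtraction.
\<close>

definition apery_recurrence :: "(nat \<Rightarrow> real) \<Rightarrow> bool" where
  "apery_recurrence X \<longleftrightarrow> (\<forall>n. (real n + 2) ^ 3 * X (Suc (Suc n))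
      = apery_poly (real n + 1) * X (Suc n) - (real n + 1) ^ 3 * X n)"

text \<open>
  Zagier's certificate: the recurrence operator, applied to the squared weights at fixed \<open>k\<close>, is the
  difference of \<open>den_cert\<close> at \<open>k\<close> and \<open>k - 1\<close>.
\<close>

definition den_cert :: "nat \<Rightarrow> nat \<Rightarrow> real" where
  "den_cert n k = 4 * (2 * real n + 1) * (real k * (2 * real k + 1) - (2 * real n + 1)\<^sup>2)
     * (apery_weight n k)\<^sup>2"

lemma den_cert_0:
  "(real n + 2) ^ 3 * (apery_weight (Suc (Suc n)) 0)\<^sup>2
     - apery_poly (real n + 1) * (apery_weight (Suc n) 0)\<^sup>2
     + (real n + 1) ^ 3 * (apery_weight n 0)\<^sup>2
   = den_cert (Suc n) 0"
proof -
  have "(x + 1) ^ 3 - apery_poly x + x ^ 3 = - 4 * (2 * x + 1) ^ 3" for x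
    unfolding apery_poly_def by algebra
  from this[of "real n + 1"] have "(real n + 2) ^ 3 - apery_poly (real n + 1) + (real n + 1) ^ 3
      = - 4 * (2 * (real n + 1) + 1) ^ 3"
    by (simp add: add.assoc)
  moreover have "den_cert (Suc n) 0 = - 4 * (2 * (real n + 1) + 1) ^ 3"
    by (simp add: den_cert_def power2_eq_square power3_eq_cube add_ac)
  ultimately show ?thesis by (simp only: apery_weight_0 one_power2 mult_1_right)
qed

text \<open>
  Both sides are the squared weight at \<open>(n + 1, k)\<close> times a rational function of \<open>n\<close> and \<open>k\<close> with
  denominator \<open>(k + 1) ^ 4\<close>, so that the claim reduces to an identity of polynomials.
\<close>

lemma den_cert_step:
  "(real n + 2) ^ 3 * (apery_weight (Suc (Suc n)) (Suc k))\<^sup>2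
     - apery_poly (real n + 1) * (apery_weight (Suc n) (Suc k))\<^sup>2
     + (real n + 1) ^ 3 * (apery_weight n (Suc k))\<^sup>2
   = den_cert (Suc n) (Suc k) - den_cert (Suc n) k"
proof -
  define x y w where "x = real n + 1" and "y = real k + 1" and "w = apery_weight (Suc n) k"
  have y: "y \<noteq> 0" by (simp add: y_def)
  have 1: "apery_weight (Suc (Suc n)) (Suc k) = w * (x + y) * (x + y + 1) / y\<^sup>2"
    using apery_weight_Suc_Suc[of "Suc n" k] y
    by (simp add: x_def y_def w_def field_simps)
  have 2: "apery_weight (Suc n) (Suc k) = w * (x - y + 1) * (x + y) / y\<^sup>2"
    using apery_weight_Suc_right[of "Suc n" k] y
    by (simp add: x_def y_def w_def field_simps)
  have 3: "apery_weight n (Suc k) = w * (x - y + 1) * (x - y) / y\<^sup>2"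
    using apery_weight_pred_Suc[of n k] y
    by (simp add: x_def y_def w_def field_simps)
  have real_eqs: "real (Suc n) = x" "real n + 2 = x + 1" "real (Suc k) = y" "real k = y - 1"
    "real n + 1 = x"
    by (simp_all add: x_def y_def)
  show ?thesis
    unfolding den_cert_def 1 2 3 w_def[symmetric] real_eqs apery_poly_def
    using y by (simp add: divide_simps) algebra
qed

lemma sum_apery_weight_extend:
  assumes "n \<le> m"
  shows "(\<Sum>k\<le>n. (apery_weight n k)\<^sup>2 * f k) = (\<Sum>k\<le>m. (apery_weight n k)\<^sup>2 * f k)"
  using assms by (intro sum.mono_neutral_left) (auto simp: apery_weight_eq_0)

lemma apery_den_recurrence: "apery_recurrence apery_den"
  unfolding apery_recurrence_def
proof
  fix n
  let ?g = "\<lambda>k. (real n + 2) ^ 3 * (apery_weight (Suc (Suc n)) k)\<^sup>2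
     - apery_poly (real n + 1) * (apery_weight (Suc n) k)\<^sup>2
     + (real n + 1) ^ 3 * (apery_weight n k)\<^sup>2"
  have "(\<Sum>k\<le>m. ?g k) = den_cert (Suc n) m" for m
  proof (induction m)
    case 0
    show ?case using den_cert_0[of n] by simp
  next
    case (Suc m)
    then show ?case using den_cert_step[of n m] by simp
  qed
  from this[of "Suc (Suc n)"] have "(\<Sum>k\<le>Suc (Suc n). ?g k) = 0"
    by (simp add: den_cert_def apery_weight_eq_0)
  moreover have "apery_den m = (\<Sum>k\<le>Suc (Suc n). (apery_weight m k)\<^sup>2)" if "m \<le> Suc (Suc n)" for m
    using sum_apery_weight_extend[OF that, of "\<lambda>_. 1"] by (simp add: apery_den_def)
  ultimately show "(real n + 2) ^ 3 * apery_den (Suc (Suc n))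
      = apery_poly (real n + 1) * apery_den (Suc n) - (real n + 1) ^ 3 * apery_den n"
    by (simp only: sum.distrib sum_subtractf sum_distrib_left[symmetric] le_SucI le_refl)
qed

section \<open>Apery's recurrence for the numerators\<close>

text \<open>
  Apery's coefficients.  The alternating correction, small by itself, is there for the telescoping
  in \<open>apery_coeff_Suc_left\<close>: with it the difference in \<open>n\<close>, like the one in \<open>k\<close>, is a rational function
  divided by the weight.  Multiplied by the squared weight it becomes summable in closed form.
\<close>

definition apery_corr :: "nat \<Rightarrow> nat \<Rightarrow> real" where
  "apery_corr n i = (-1) ^ i / (2 * (real i + 1) ^ 3 * apery_weight n (Suc i))"

definition apery_coeff :: "nat \<Rightarrow> nat \<Rightarrow> real" where
  "apery_coeff n k = (\<Sum>m<n. 1 / real (Suc m) ^ 3) + (\<Sum>i<k. apery_corr n i)"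

definition apery_num :: "nat \<Rightarrow> real" where
  "apery_num n = (\<Sum>k\<le>n. (apery_weight n k)\<^sup>2 * apery_coeff n k)"

lemma apery_coeff_Suc_right: "apery_coeff n (Suc k) = apery_coeff n k + apery_corr n k"
  by (simp add: apery_coeff_def)

lemma apery_coeff_Suc_left_0:
  "(real n + 1) ^ 3 * apery_coeff (Suc n) 0 = (real n + 1) ^ 3 * apery_coeff n 0 + 1"
proof -
  have "apery_coeff (Suc n) 0 = apery_coeff n 0 + 1 / (real n + 1) ^ 3"
    by (simp add: apery_coeff_def add_ac)
  then show ?thesis by (simp add: distrib_left add_eq_0_iff)
qed

text \<open>
  Induction on \<open>k\<close>: the closed form telescopes against the change of the correction terms from
  \<open>n\<close> to \<open>n + 1\<close>.  On the diagonal and below, no weight in a denominator vanishes.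
\<close>

lemma apery_coeff_Suc_left:
  "k \<le> n \<Longrightarrow> apery_coeff (Suc n) k - apery_coeff n k
     = (-1) ^ k / ((real n + 1)\<^sup>2 * (real n + 1 + real k) * apery_weight n k)"
proof (induction k)
  case 0
  have "(real n + 1) ^ 3 * (apery_coeff (Suc n) 0 - apery_coeff n 0) = 1"
    using apery_coeff_Suc_left_0[of n] by (simp add: right_diff_distrib)
  then have "apery_coeff (Suc n) 0 - apery_coeff n 0 = 1 / (real n + 1) ^ 3"
    by (auto simp: eq_divide_eq mult.commute)
  then show ?case by (simp add: power3_eq_cube power2_eq_square)
next
  case (Suc k)
  define x y w where "x = real n + 1" and "y = real k + 1" and "w = apery_weight n k"
  have pos: "y > 0" "x - y > 0" "w > 0" "x > 0"
    using Suc.prems by (simp_all add: x_def y_def w_def apery_weight_pos)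
  have 1: "apery_weight n (Suc k) = w * (x - y) * (x + y - 1) / y\<^sup>2"
    using apery_weight_Suc_right[of n k] pos by (simp add: x_def y_def w_def field_simps)
  have 2: "apery_weight (Suc n) (Suc k) = w * (x + y - 1) * (x + y) / y\<^sup>2"
    using apery_weight_Suc_Suc[of n k] pos by (simp add: x_def y_def w_def field_simps)
  have IH: "apery_coeff (Suc n) k - apery_coeff n k = (-1) ^ k / (x\<^sup>2 * (x + y - 1) * w)"
    using Suc by (simp add: x_def y_def w_def)
  have pos': "x + y - 1 > 0" "x + y > 0" using pos Suc.prems by (simp_all add: x_def y_def)
  define s :: real where "s = (-1) ^ k"
  have "apery_coeff (Suc n) (Suc k) - apery_coeff n (Suc k)
      = s / (x\<^sup>2 * (x + y - 1) * w)
        + s / (2 * y ^ 3 * (w * (x + y - 1) * (x + y) / y\<^sup>2))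
        - s / (2 * y ^ 3 * (w * (x - y) * (x + y - 1) / y\<^sup>2))"
    unfolding apery_coeff_Suc_right apery_corr_def 1 2 y_def[symmetric] s_def using IH by simp
  also have "\<dots> = - s / (x\<^sup>2 * (x + y) * (w * (x - y) * (x + y - 1) / y\<^sup>2))"
    using pos pos' by (simp add: divide_simps) algebra
  finally show ?case unfolding 1 s_def by (simp add: x_def y_def add.assoc)
qed

text \<open>
  Summation by parts explains the certificate.  If \<open>apery_coeff\<close> did not depend on \<open>n\<close> and \<open>k\<close>, its
  product with \<open>den_cert\<close> would do; its variation in \<open>n\<close> and \<open>k\<close> contributes terms of first order in
  the weight, and these telescope to the second summand.  The certificate is evaluated at positive
  first arguments only, so that its denominator is not zero.
\<close>

definition num_cert :: "nat \<Rightarrow> nat \<Rightarrow> real" where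
  "num_cert n k = den_cert n k * apery_coeff n k
     - 5 * (2 * real n + 1) * (-1) ^ k * real k / (real n * (real n + 1)) * apery_weight n k"

definition num_term :: "nat \<Rightarrow> nat \<Rightarrow> real" where
  "num_term n k = (real n + 2) ^ 3 * ((apery_weight (Suc (Suc n)) k)\<^sup>2 * apery_coeff (Suc (Suc n)) k)
     - apery_poly (real n + 1) * ((apery_weight (Suc n) k)\<^sup>2 * apery_coeff (Suc n) k)
     + (real n + 1) ^ 3 * ((apery_weight n k)\<^sup>2 * apery_coeff n k)"

lemma num_term_0: "num_term n 0 = num_cert (Suc n) 0"
proof -
  have "(real n + 2) ^ 3 * apery_coeff (Suc (Suc n)) 0
      = (real n + 2) ^ 3 * apery_coeff (Suc n) 0 + 1"
    using apery_coeff_Suc_left_0[of "Suc n"] by (simp add: add.commute)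
  then have "num_term n 0 = ((real n + 2) ^ 3 - apery_poly (real n + 1) + (real n + 1) ^ 3)
      * apery_coeff (Suc n) 0"
    using apery_coeff_Suc_left_0[of n] by (simp add: num_term_def algebra_simps)
  then show ?thesis
    using den_cert_0[of n] by (simp add: num_cert_def)
qed

lemma num_term_Suc:
  assumes "k \<le> n"
  shows "num_term n (Suc k) = num_cert (Suc n) (Suc k) - num_cert (Suc n) k"
proof -
  define x y w where "x = real n + 1" and "y = real k + 1" and "w = apery_weight (Suc n) k"
  define s :: real where "s = (-1) ^ k"
  define W0 W1 W2 where "W0 = apery_weight n (Suc k)" and "W1 = apery_weight (Suc n) (Suc k)"
    and "W2 = apery_weight (Suc (Suc n)) (Suc k)"
  define c0 c1 where "c0 = apery_coeff (Suc n) k" and "c1 = apery_coeff (Suc n) (Suc k)"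
  have pos: "y > 0" "x > 0" "w > 0" "x - y + 1 > 0" "x + y > 0" "x + y + 1 > 0" "W1 > 0" "x + 1 > 0"
    using assms by (simp_all add: x_def y_def w_def W1_def apery_weight_pos)
  have real_eqs: "real (Suc n) = x" "real n + 2 = x + 1" "real (Suc k) = y" "real k = y - 1"
    "real n + 1 = x"
    by (simp_all add: x_def y_def)
  have W2: "W2 = w * (x + y) * (x + y + 1) / y\<^sup>2"
    using apery_weight_Suc_Suc[of "Suc n" k] pos
    by (simp add: x_def y_def w_def W2_def field_simps)
  have W1: "W1 = w * (x - y + 1) * (x + y) / y\<^sup>2"
    using apery_weight_Suc_right[of "Suc n" k] pos
    by (simp add: x_def y_def w_def W1_def field_simps)
  have W0: "W0 = w * (x - y + 1) * (x - y) / y\<^sup>2"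
    using apery_weight_pred_Suc[of n k] pos
    by (simp add: x_def y_def w_def W0_def field_simps)
  have c1: "c1 = c0 + s / (2 * y ^ 3 * W1)"
    by (simp add: c0_def c1_def apery_coeff_Suc_right apery_corr_def W1_def y_def s_def)
  have up: "apery_coeff (Suc (Suc n)) (Suc k) = c1 - s / ((x + 1)\<^sup>2 * (x + y + 1) * W1)"
    using apery_coeff_Suc_left[of "Suc k" "Suc n"] assms
    by (simp add: c1_def W1_def s_def x_def y_def ac_simps)
  \<comment> \<open>For \<open>k = n\<close> the coefficient formula does not apply, but both sides carry the factor \<open>W0 = 0\<close>.\<close>
  have down: "W0\<^sup>2 * apery_coeff n (Suc k) = W0\<^sup>2 * c1 + s * W0 / (x\<^sup>2 * (x + y))"
  proof (cases "k = n")
    case True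
    then show ?thesis by (simp add: W0_def apery_weight_eq_0)
  next
    case False
    with assms have "Suc k \<le> n" by simp
    then have "c1 - apery_coeff n (Suc k) = - s / (x\<^sup>2 * (x + y) * W0)" and "W0 > 0"
      using apery_coeff_Suc_left[of "Suc k" n]
      by (simp_all add: c1_def W0_def s_def x_def y_def ac_simps apery_weight_pos)
    then have "apery_coeff n (Suc k) = c1 + s / (x\<^sup>2 * (x + y) * W0)" by simp
    with \<open>W0 > 0\<close> pos show ?thesis by (simp add: divide_simps) algebra
  qed
  have "num_term n (Suc k)
      = c1 * ((x + 1) ^ 3 * W2\<^sup>2 - apery_poly x * W1\<^sup>2 + x ^ 3 * W0\<^sup>2)
        - (x + 1) ^ 3 * W2\<^sup>2 * (s / ((x + 1)\<^sup>2 * (x + y + 1) * W1))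
        + x ^ 3 * (s * W0 / (x\<^sup>2 * (x + y)))"
    unfolding num_term_def up real_eqs W0_def[symmetric] W1_def[symmetric] W2_def[symmetric]
      c1_def[symmetric] down
    by (simp only: algebra_simps)
  also have "(x + 1) ^ 3 * W2\<^sup>2 - apery_poly x * W1\<^sup>2 + x ^ 3 * W0\<^sup>2
      = den_cert (Suc n) (Suc k) - den_cert (Suc n) k"
    using den_cert_step[of n k] unfolding real_eqs W0_def W1_def W2_def .
  also have "c1 * (den_cert (Suc n) (Suc k) - den_cert (Suc n) k)
      = den_cert (Suc n) (Suc k) * c1 - den_cert (Suc n) k * c0
        - den_cert (Suc n) k * (s / (2 * y ^ 3 * W1))"
    unfolding c1 by (simp only: algebra_simps)
  also have "(x + 1) ^ 3 * W2\<^sup>2 * (s / ((x + 1)\<^sup>2 * (x + y + 1) * W1))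
      = s * ((x + 1) * W2\<^sup>2 / ((x + y + 1) * W1))"
    using pos by (simp add: power2_eq_square power3_eq_cube)
  also have "x ^ 3 * (s * W0 / (x\<^sup>2 * (x + y))) = s * (x * W0 / (x + y))"
    using pos by (simp add: power2_eq_square power3_eq_cube)
  also have "den_cert (Suc n) k * (s / (2 * y ^ 3 * W1)) = s * (den_cert (Suc n) k / (2 * y ^ 3 * W1))"
    by simp
  finally have eq: "num_term n (Suc k)
      = den_cert (Suc n) (Suc k) * c1 - den_cert (Suc n) k * c0
        + s * (x * W0 / (x + y) - (x + 1) * W2\<^sup>2 / ((x + y + 1) * W1)
               - den_cert (Suc n) k / (2 * y ^ 3 * W1))"
    by (simp only: algebra_simps)
  have den: "den_cert (Suc n) k
      = 4 * (2 * x + 1) * ((y - 1) * (2 * y - 1) - (2 * x + 1)\<^sup>2) * w\<^sup>2"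
    unfolding den_cert_def real_eqs w_def by (simp add: algebra_simps)
  \<comment> \<open>Each quotient of two weights cancels to a rational function times \<open>w\<close>.\<close>
  have first_order: "x * W0 / (x + y) - (x + 1) * W2\<^sup>2 / ((x + y + 1) * W1)
         - den_cert (Suc n) k / (2 * y ^ 3 * W1)
      = 5 * (2 * x + 1) * y / (x * (x + 1)) * W1 + 5 * (2 * x + 1) * (y - 1) / (x * (x + 1)) * w"
    unfolding W0 W1 W2 den using pos by (simp add: divide_simps) algebra
  show ?thesis
    unfolding eq first_order num_cert_def real_eqs c0_def[symmetric] c1_def[symmetric] w_def[symmetric]
      W1_def[symmetric] by (simp add: s_def algebra_simps add_divide_distrib diff_divide_distrib)
qed

text \<open>
  At \<open>k = n + 2\<close> only the first of the three summands survives, and its coefficient is not reached by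
  the difference formula in \<open>n\<close>.  It is computed from \<open>(n + 1, n + 1)\<close> by one step in \<open>n\<close> followed by
  one step in \<open>k\<close>.
\<close>

lemma num_term_last: "num_term n (Suc (Suc n)) = - num_cert (Suc n) (Suc n)"
proof -
  define x v where "x = real n + 1" and "v = apery_weight (Suc n) (Suc n)"
  define s :: real where "s = (-1) ^ Suc n"
  define c where "c = apery_coeff (Suc n) (Suc n)"
  have pos: "x > 0" "v > 0" "2 * x + 1 > 0" "x + 1 > 0"
    by (simp_all add: x_def v_def apery_weight_pos)
  have W: "apery_weight (Suc (Suc n)) (Suc (Suc n)) = v * (2 * (2 * x + 1)) / (x + 1)"
  proof -
    have "apery_weight (Suc (Suc n)) (Suc (Suc n)) * (x + 1)\<^sup>2 = v * (2 * x + 1) * (2 * x + 2)"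
      using apery_weight_Suc_Suc[of "Suc n" "Suc n"] by (simp add: x_def v_def algebra_simps)
    then have "apery_weight (Suc (Suc n)) (Suc (Suc n)) = v * (2 * x + 1) * (2 * x + 2) / (x + 1)\<^sup>2"
      using pos by (simp add: eq_divide_eq)
    also have "\<dots> = v * (2 * (2 * x + 1)) / (x + 1)"
      using pos by (simp add: divide_simps) algebra
    finally show ?thesis .
  qed
  have "apery_coeff (Suc (Suc n)) (Suc (Suc n))
      = c + s / ((x + 1)\<^sup>2 * (2 * x + 1) * v)
        + s / (2 * (x + 1) ^ 3 * (v * (2 * (2 * x + 1)) / (x + 1)))"
    using apery_coeff_Suc_left[of "Suc n" "Suc n"]
    unfolding apery_coeff_Suc_right[of _ "Suc n"] apery_corr_def W
    by (simp add: c_def s_def x_def v_def algebra_simps)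
  then have "num_term n (Suc (Suc n)) = (x + 1) ^ 3 * ((v * (2 * (2 * x + 1)) / (x + 1))\<^sup>2
      * (c + s / ((x + 1)\<^sup>2 * (2 * x + 1) * v)
        + s / (2 * (x + 1) ^ 3 * (v * (2 * (2 * x + 1)) / (x + 1)))))"
    unfolding num_term_def W by (simp add: apery_weight_eq_0 x_def add.assoc)
  also have "\<dots> = 4 * (2 * x + 1)\<^sup>2 * (x + 1) * v\<^sup>2 * c + 5 * (2 * x + 1) * s / (x + 1) * v"
    using pos by (simp add: divide_simps) algebra
  also have "\<dots> = - num_cert (Suc n) (Suc n)"
  proof -
    have den: "den_cert (Suc n) (Suc n)
        = 4 * (2 * x + 1) * (x * (2 * x + 1) - (2 * x + 1)\<^sup>2) * v\<^sup>2"
      by (simp add: den_cert_def v_def x_def algebra_simps)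
    have num: "num_cert (Suc n) (Suc n)
        = den_cert (Suc n) (Suc n) * c - 5 * (2 * x + 1) * s * x / (x * (x + 1)) * v"
      by (simp add: num_cert_def v_def x_def c_def s_def add.commute)
    show ?thesis
      unfolding num den using pos by (simp add: divide_simps) algebra
  qed
  finally show ?thesis .
qed

lemma apery_num_recurrence: "apery_recurrence apery_num"
  unfolding apery_recurrence_def
proof
  fix n
  have "(\<Sum>k\<le>m. num_term n k) = num_cert (Suc n) m" if "m \<le> Suc n" for m
    using that
  proof (induction m)
    case 0
    show ?case by (simp add: num_term_0)
  next
    case (Suc m)
    then show ?case using num_term_Suc[of m n] by simp
  qed
  then have "(\<Sum>k\<le>Suc (Suc n). num_term n k) = 0"
    by (subst sum.atMost_Suc) (simp only: num_term_last le_refl add.right_inverse)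
  moreover have "apery_num m = (\<Sum>k\<le>Suc (Suc n). (apery_weight m k)\<^sup>2 * apery_coeff m k)"
    if "m \<le> Suc (Suc n)" for m
    using sum_apery_weight_extend[OF that] by (simp add: apery_num_def)
  ultimately show "(real n + 2) ^ 3 * apery_num (Suc (Suc n))
      = apery_poly (real n + 1) * apery_num (Suc n) - (real n + 1) ^ 3 * apery_num n"
    by (simp only: num_term_def sum.distrib sum_subtractf sum_distrib_left[symmetric] le_SucI le_refl)
qed

section \<open>Convergence to zeta(3)\<close>

lemma apery_den_pos: "apery_den n > 0"
  unfolding apery_den_def by (intro sum_pos) (auto simp: apery_weight_pos less_imp_neq[symmetric])

lemma summable_inverse_cubes: "summable (\<lambda>m. 1 / real (Suc m) ^ 3)"
  using inverse_power_summable[of 3, where 'a = real]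
  by (subst summable_Suc_iff[of "\<lambda>m. 1 / real m ^ 3"]) (simp add: inverse_eq_divide)

definition apery_err :: "nat \<Rightarrow> real" where
  "apery_err n = \<bar>(\<Sum>m<n. 1 / real (Suc m) ^ 3) - zeta3\<bar> + zeta3 / (2 * (real n + 1))"

lemma zeta3_nonneg: "zeta3 \<ge> 0"
  unfolding zeta3_def by (intro suminf_nonneg summable_inverse_cubes) simp

lemma apery_err_nonneg: "apery_err n \<ge> 0"
  using zeta3_nonneg by (simp add: apery_err_def)

lemma apery_err_tendsto: "apery_err \<longlonglongrightarrow> 0"
proof -
  have "(\<lambda>n. \<Sum>m<n. 1 / real (Suc m) ^ 3) \<longlonglongrightarrow> zeta3"
    using summable_LIMSEQ[OF summable_inverse_cubes] by (simp add: zeta3_def)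
  then have "(\<lambda>n. \<bar>(\<Sum>m<n. 1 / real (Suc m) ^ 3) - zeta3\<bar>) \<longlonglongrightarrow> 0"
    by (intro tendsto_rabs_zero) (rule LIM_zero)
  moreover have "(\<lambda>n. zeta3 / 2 * (1 / real (Suc n))) \<longlonglongrightarrow> zeta3 / 2 * 0"
    by (intro tendsto_mult tendsto_const LIMSEQ_Suc lim_1_over_n)
  ultimately have "(\<lambda>n. \<bar>(\<Sum>m<n. 1 / real (Suc m) ^ 3) - zeta3\<bar> + zeta3 / 2 * (1 / real (Suc n)))
      \<longlonglongrightarrow> 0 + zeta3 / 2 * 0"
    by (rule tendsto_add)
  then show ?thesis by (simp add: apery_err_def[abs_def] algebra_simps)
qed

text \<open>
  Every weight with \<open>0 < k \<le> n\<close> is at least \<open>n + 1\<close>, so the correction is at most \<open>1 / (2 (n + 1))\<close>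
  times a partial sum of \<open>\<zeta>(3)\<close>.
\<close>

lemma apery_coeff_bound:
  assumes "k \<le> n"
  shows "\<bar>apery_coeff n k - zeta3\<bar> \<le> apery_err n"
proof -
  have "\<bar>\<Sum>i<k. apery_corr n i\<bar> \<le> (\<Sum>i<k. \<bar>apery_corr n i\<bar>)"
    by (rule sum_abs)
  also have "\<dots> \<le> (\<Sum>i<k. 1 / (2 * (real n + 1)) * (1 / real (Suc i) ^ 3))"
  proof (rule sum_mono)
    fix i assume "i \<in> {..<k}"
    then have w: "real n + 1 \<le> apery_weight n (Suc i)"
      using assms by (intro Suc_le_apery_weight) auto
    have "\<bar>apery_corr n i\<bar> = 1 / (2 * (real i + 1) ^ 3 * apery_weight n (Suc i))"
      using w by (simp add: apery_corr_def abs_mult power_abs)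
    also have "\<dots> \<le> 1 / (2 * (real i + 1) ^ 3 * (real n + 1))"
      using w by (intro divide_left_mono mult_left_mono mult_pos_pos) auto
    finally show "\<bar>apery_corr n i\<bar> \<le> 1 / (2 * (real n + 1)) * (1 / real (Suc i) ^ 3)"
      by (simp only: divide_divide_eq_left times_divide_times_eq mult_1_left of_nat_Suc add.commute mult_ac)
  qed
  also have "\<dots> = 1 / (2 * (real n + 1)) * (\<Sum>i<k. 1 / real (Suc i) ^ 3)"
    by (simp add: sum_distrib_left)
  also have "\<dots> \<le> 1 / (2 * (real n + 1)) * zeta3"
    unfolding zeta3_def
    by (intro mult_left_mono sum_le_suminf[OF summable_inverse_cubes]) auto
  finally show ?thesis by (simp add: apery_coeff_def apery_err_def)
qed

lemma apery_num_bound: "\<bar>apery_num n - zeta3 * apery_den n\<bar> \<le> apery_err n * apery_den n"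
proof -
  have "apery_num n - zeta3 * apery_den n
      = (\<Sum>k\<le>n. (apery_weight n k)\<^sup>2 * (apery_coeff n k - zeta3))"
    by (simp add: apery_num_def apery_den_def sum_distrib_left right_diff_distrib sum_subtractf
        mult.commute[of zeta3])
  also have "\<bar>\<dots>\<bar> \<le> (\<Sum>k\<le>n. \<bar>(apery_weight n k)\<^sup>2 * (apery_coeff n k - zeta3)\<bar>)"
    by (rule sum_abs)
  also have "\<dots> \<le> (\<Sum>k\<le>n. apery_err n * (apery_weight n k)\<^sup>2)"
    by (intro sum_mono)
       (simp add: abs_mult apery_coeff_bound mult_left_mono mult.commute[of "apery_err n"])
  finally show ?thesis by (simp add: apery_den_def sum_distrib_left)
qed

section \<open>The continued fraction\<close>

text \<open>
  Write \<open>Y n = 3 X (n+1) + X n\<close> for a solution \<open>X\<close> of Apery's recurrence, and \<open>m = n + 1\<close>.  The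
  determinant of the linear map that takes \<open>(X n, X (n+1))\<close> to \<open>(Y n, Y (n+1))\<close> is
  \<open>4 * comb_det m / (m + 1) ^ 3\<close>.  This is how the cubic factors enter the partial numerators: in a
  recurrence \<open>Y (n+2) = \<alpha> Y (n+1) + \<beta> Y n\<close> the coefficient \<open>\<beta>\<close> is, by Cramer's rule, minus the
  quotient of the determinants of \<open>(Y (n+1), Y (n+2))\<close> and \<open>(Y n, Y (n+1))\<close> in a common basis.
\<close>

definition comb_det :: "real \<Rightarrow> real" where
  "comb_det x = 28 * x ^ 3 + 39 * x\<^sup>2 + 21 * x + 4"

text \<open>
  The first two values are read off from the convergents \<open>9 / 8\<close> and \<open>3231 / 2688\<close>, which are
  \<open>18 / 16\<close> and \<open>(1077 / 4) / 224\<close> before scaling.  Each later step multiplies by the leading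
  coefficient in \<open>combination_recurrence\<close>, which turns that recurrence into one with leading
  coefficient \<open>1\<close>.
\<close>

fun cf_scale :: "nat \<Rightarrow> real" where
  "cf_scale 0 = 1 / 2"
| "cf_scale (Suc 0) = 12"
| "cf_scale (Suc (Suc n)) = 3 * (real n + 3) ^ 3
     * comb_det (real n + 1) * cf_scale (Suc n)"

lemma cf_scale_pos: "cf_scale n > 0"
proof (induction n rule: cf_scale.induct)
  case (3 n)
  have "comb_det (real n + 1) > 0"
    unfolding comb_det_def by (intro add_nonneg_pos add_nonneg_nonneg) auto
  with 3 show ?case by (simp only: cf_scale.simps) (intro mult_pos_pos, auto)
qed simp_all

text \<open>
  Two consecutive instances of Apery's recurrence express \<open>X n\<close> and \<open>X (n+3)\<close> by \<open>X (n+1)\<close> and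
  \<open>X (n+2)\<close>.  The claim then holds coefficientwise.
\<close>

lemma combination_recurrence:
  assumes "apery_recurrence X"
  defines "Y \<equiv> \<lambda>n. 3 * X (Suc n) + X n"
  shows "3 * (real n + 3) ^ 3 * comb_det (real n + 1)
        * Y (Suc (Suc n))
     = Q_poly (real n + 3) * Y (Suc n)
       - 3 * (real n + 1) ^ 3 * comb_det (real n + 2)
         * Y n"
proof -
  have r: "(real n + 2) ^ 3 * X (Suc (Suc n))
      = apery_poly (real n + 1) * X (Suc n) - (real n + 1) ^ 3 * X n"
    and r': "(real n + 3) ^ 3 * X (Suc (Suc (Suc n)))
      = apery_poly (real n + 2) * X (Suc (Suc n)) - (real n + 2) ^ 3 * X (Suc n)"
    using assms(1) unfolding apery_recurrence_def
    by (blast, drule_tac x = "Suc n" in spec, simp add: algebra_simps)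
  show ?thesis
    using r r' unfolding Y_def Q_poly_def apery_poly_def comb_det_def by algebra
qed

lemma cf_solution_eq:
  assumes X: "apery_recurrence X"
    and r: "\<And>n. r (Suc (Suc n)) = partial_den (n + 2) * r (Suc n) + partial_num (n + 2) * r n"
    and r1: "r 1 = (3 * X 1 + X 0) / 2"
    and r2: "r 2 = 12 * (3 * X 2 + X 1)"
  shows "r (Suc n) = cf_scale n * (3 * X (Suc n) + X n)"
proof (induction n rule: induct_nat_012)
  case 0
  show ?case using r1 by simp
next
  case 1
  show ?case using r2 by (simp add: numeral_2_eq_2)
next
  case (ge2 n)
  let ?Y = "\<lambda>n. 3 * X (Suc n) + X n"
  have step: "3 * (real n + 3) ^ 3 * comb_det (real n + 1) * ?Y (Suc (Suc n))
      = Q_poly (real n + 3) * ?Y (Suc n) - 3 * (real n + 1) ^ 3 * comb_det (real n + 2) * ?Y n"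
    using combination_recurrence[OF X, of n] by simp
  \<comment> \<open>The general rule would give \<open>cf_scale 1 = 48\<close> instead of \<open>12\<close>.  The factor \<open>4\<close> is the one
     between \<open>P_poly 3\<close> and the third partial numerator.\<close>
  have scale: "partial_num (n + 3) * cf_scale n
      = - 3 * (real n + 1) ^ 3 * comb_det (real n + 2) * cf_scale (Suc n)"
  proof (cases n)
    case 0
    then show ?thesis by (simp add: partial_num_def comb_det_def)
  next
    case (Suc m)
    have P: "P_poly (x + 3) = - 9 * (x + 1) ^ 3 * (x + 2) ^ 3 * comb_det x * comb_det (x + 2)" for x
      unfolding P_poly_def comb_det_def by algebra
    have "partial_num (n + 3) = P_poly (real n + 3)"
      using Suc by (simp add: partial_num_def add.commute)
    moreover have "cf_scale (Suc n) = 3 * (real n + 2) ^ 3 * comb_det (real n) * cf_scale n"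
      using Suc by (simp add: algebra_simps)
    ultimately show ?thesis unfolding P by (simp only: mult_ac)
  qed
  have "partial_den (n + 3) = Q_poly (real n + 3)"
    by (simp add: partial_den_def add.commute)
  then have "r (Suc (Suc (Suc n)))
      = Q_poly (real n + 3) * (cf_scale (Suc n) * ?Y (Suc n))
        + (partial_num (n + 3) * cf_scale n) * ?Y n"
    using r[of "Suc n"] ge2 by (simp add: numeral_3_eq_3)
  also have "\<dots> = cf_scale (Suc n) * (Q_poly (real n + 3) * ?Y (Suc n)
      - 3 * (real n + 1) ^ 3 * comb_det (real n + 2) * ?Y n)"
    unfolding scale by (simp only: algebra_simps)
  also have "\<dots> = cf_scale (Suc (Suc n)) * ?Y (Suc (Suc n))"
    unfolding step[symmetric] by (simp only: cf_scale.simps mult_ac)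
  finally show ?case .
qed

lemma apery_initial_values:
  "apery_den 0 = 1" "apery_den 1 = 5" "apery_den 2 = 73"
  "apery_num 0 = 0" "apery_num 1 = 6" "apery_num 2 = 351 / 4"
  by (simp_all add: apery_den_def apery_num_def apery_coeff_def apery_corr_def apery_weight_def
      numeral_2_eq_2)

theorem corollary4p4:
  "cf_equals partial_den partial_num zeta3"
proof -
  define D where "D = (\<lambda>n. 3 * apery_den (Suc n) + apery_den n)"
  define E where "E = (\<lambda>n. 3 * apery_num (Suc n) + apery_num n)"
  have den: "cf_den partial_den partial_num (Suc n) = cf_scale n * D n" for n
    unfolding D_def
    by (rule cf_solution_eq[OF apery_den_recurrence])
       (simp_all add: apery_initial_values[unfolded One_nat_def numeral_2_eq_2] numeral_2_eq_2
          partial_den_def partial_num_def)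
  have num: "cf_num partial_den partial_num (Suc n) = cf_scale n * E n" for n
    unfolding E_def
    by (rule cf_solution_eq[OF apery_num_recurrence])
       (simp_all add: apery_initial_values[unfolded One_nat_def numeral_2_eq_2] numeral_2_eq_2
          partial_den_def partial_num_def)
  have Dpos: "D n > 0" for n
    using apery_den_pos[of n] apery_den_pos[of "Suc n"] by (simp add: D_def)
  \<comment> \<open>A weighted mean of two errors is at most their sum.\<close>
  have bound: "\<bar>E n / D n - zeta3\<bar> \<le> apery_err (Suc n) + apery_err n" for n
  proof -
    have weighted: "\<bar>3 * u + v\<bar> \<le> 3 * a + b" if "\<bar>v\<bar> \<le> b" "\<bar>u\<bar> \<le> a" for u v a b :: real
      using that by linarith
    let ?A = "apery_den (Suc n)" and ?B = "apery_den n"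
    have "E n - zeta3 * D n
        = 3 * (apery_num (Suc n) - zeta3 * ?A) + (apery_num n - zeta3 * ?B)"
      by (simp add: D_def E_def algebra_simps)
    also have "\<bar>\<dots>\<bar> \<le> 3 * (apery_err (Suc n) * ?A) + apery_err n * ?B"
      using apery_num_bound[of n] apery_num_bound[of "Suc n"] by (rule weighted)
    also have "\<dots> \<le> (apery_err (Suc n) + apery_err n) * D n"
      using apery_den_pos[of n] apery_den_pos[of "Suc n"] apery_err_nonneg[of n]
        apery_err_nonneg[of "Suc n"]
      by (simp add: D_def algebra_simps)
    finally have "\<bar>E n - zeta3 * D n\<bar> / D n \<le> apery_err (Suc n) + apery_err n"
      using Dpos[of n] by (simp add: pos_divide_le_eq)
    moreover have "E n / D n - zeta3 = (E n - zeta3 * D n) / D n"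
      using Dpos[of n] by (simp add: field_simps)
    ultimately show ?thesis using Dpos[of n] by (simp add: abs_divide)
  qed
  have "(\<lambda>n. apery_err (Suc n) + apery_err n) \<longlonglongrightarrow> 0 + 0"
    by (intro tendsto_add LIMSEQ_Suc apery_err_tendsto)
  then have "(\<lambda>n. apery_err (Suc n) + apery_err n) \<longlonglongrightarrow> 0" by simp
  moreover have "\<forall>n. norm (E n / D n - zeta3) \<le> apery_err (Suc n) + apery_err n"
    unfolding real_norm_def by (intro allI bound)
  ultimately have "(\<lambda>n. E n / D n - zeta3) \<longlonglongrightarrow> 0"
    by (rule Lim_null_comparison[OF always_eventually, rotated])
  then have lim: "(\<lambda>n. E n / D n) \<longlonglongrightarrow> zeta3"
    by (rule LIM_zero_cancel)
  have nz: "cf_den partial_den partial_num (Suc n) \<noteq> 0" for n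
    using Dpos[of n] cf_scale_pos[of n] by (simp add: den)
  have "cf_num partial_den partial_num (Suc n) / cf_den partial_den partial_num (Suc n)
      = E n / D n" for n
    using cf_scale_pos[of n] by (simp add: den num)
  with lim have "(\<lambda>n. cf_num partial_den partial_num (Suc n) / cf_den partial_den partial_num (Suc n))
      \<longlonglongrightarrow> zeta3"
    by (simp only:)
  then have "(\<lambda>n. cf_num partial_den partial_num n / cf_den partial_den partial_num n)
      \<longlonglongrightarrow> zeta3"
    by (rule LIMSEQ_imp_Suc)
  moreover have "\<forall>\<^sub>F n in sequentially. cf_den partial_den partial_num n \<noteq> 0"
    using nz by (subst eventually_sequentially_Suc[symmetric]) simp
  ultimately show ?thesis unfolding cf_equals_def by simp
qed

end
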